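(* Let $\psi(f,g,h,u,v,w)=f(v-w)+g(w-u)+h(u-v)$. For arbitrary parameters $p,q,r,a,b,c$, define \[ \begin{aligned} x_1&=\psi(p,q,r,a,b,c), & x_2&=\psi(p,q,r,b,c,a), & x_3&=\psi(p,q,r,c,a,b),\\ y_1&=\psi(p,q,r,a,c,b), & y_2&=\psi(p,q,r,c,b,a), & y_3&=\psi(p,q,r,b,a,c), \end{aligned} \] and set $x_4=-x_1$, $x_5=-x_2$, $x_6=-x_3$, $y_4=-y_1$, $y_5=-y_2$, $y_6=-y_3$. Then \[ \sum_{i=1}^6 x_i^j=\sum_{i=1}^6 y_i^j \quad\text{for } j=1,2,3,4,5. \]
   Context: Parameters $p,q,r,a,b,c$ are arbitrary integers (or rationals). *)

theory Defs
  imports Complex_Main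
begin

(* The parameters are rational numbers; integer parameters are the special case
   in which all arguments lie in the subring of integers. *)
definition psi :: "rat \<Rightarrow> rat \<Rightarrow> rat \<Rightarrow> rat \<Rightarrow> rat \<Rightarrow> rat \<Rightarrow> rat" where
  "psi f g h u v w = f * (v - w) + g * (w - u) + h * (u - v)"

end

theory Submission
  imports Defs
begin

text \<open>The odd power sums vanish because each sextuple is symmetric about the origin. Each of the
  triples \<open>x\<^sub>1, x\<^sub>2, x\<^sub>3\<close> and \<open>y\<^sub>1, y\<^sub>2, y\<^sub>3\<close> has sum zero, so its fourth power sum is half the
  square of its second power sum; hence only the equality of the second power sums has to be
  verified by expansion.\<close>

text \<open>With \<open>e = s*t + t*u + u*s\<close>, both sides equal \<open>4 * e^2\<close>. The
  factor 2 avoids division.\<close>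

lemma sum_fourth_powers_if_sum_zero:
  fixes s t u :: "'a::comm_ring_1"
  assumes "s + t + u = 0"
  shows "2 * (s ^ 4 + t ^ 4 + u ^ 4) = (s\<^sup>2 + t\<^sup>2 + u\<^sup>2)\<^sup>2"
proof -
  have u: "u = - (s + t)"
    using assms by (metis minus_unique)
  show ?thesis
    unfolding u by (simp add: power2_eq_square power4_eq_xxxx algebra_simps)
qed

lemma psi_cyclic_sum: "psi p q r a b c + psi p q r b c a + psi p q r c a b = 0"
  by (simp add: psi_def power2_eq_square algebra_simps)

text \<open>As quadratic forms in \<open>p\<close>, \<open>q\<close>, \<open>r\<close>, both sides
  have coefficients symmetric in \<open>a\<close>, \<open>b\<close>, \<open>c\<close>.\<close>

lemma psi_sum_squares:
  "(psi p q r a b c)\<^sup>2 + (psi p q r b c a)\<^sup>2 + (psi p q r c a b)\<^sup>2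
    = (psi p q r a c b)\<^sup>2 + (psi p q r c b a)\<^sup>2 + (psi p q r b a c)\<^sup>2"
  by (simp add: psi_def power2_eq_square algebra_simps)

lemma psi_sum_fourth_powers:
  "psi p q r a b c ^ 4 + psi p q r b c a ^ 4 + psi p q r c a b ^ 4
    = psi p q r a c b ^ 4 + psi p q r c b a ^ 4 + psi p q r b a c ^ 4"
  using sum_fourth_powers_if_sum_zero[OF psi_cyclic_sum[of p q r a b c]]
    \<comment> \<open>The second triple is the first with \<open>b\<close> and \<open>c\<close>
      swapped.\<close>
    sum_fourth_powers_if_sum_zero[OF psi_cyclic_sum[of p q r a c b]]
    psi_sum_squares[of p q r a b c]
  by simp

lemma sum_one_to_six:
  fixes f :: "nat \<Rightarrow> 'a::comm_monoid_add"
  shows "(\<Sum>i = 1..6. f i) = f 1 + f 2 + f 3 + f 4 + f 5 + f 6"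
  by (simp add: eval_nat_numeral)

theorem theorem5:
  fixes p q r a b c :: rat and x y :: "nat \<Rightarrow> rat"
  assumes "x 1 = psi p q r a b c" and "x 2 = psi p q r b c a" and "x 3 = psi p q r c a b"
    and "y 1 = psi p q r a c b" and "y 2 = psi p q r c b a" and "y 3 = psi p q r b a c"
    and "x 4 = - x 1" and "x 5 = - x 2" and "x 6 = - x 3"
    and "y 4 = - y 1" and "y 5 = - y 2" and "y 6 = - y 3"
  shows "\<forall>j\<in>{1, 2, 3, 4, 5::nat}. (\<Sum>i = 1..6. x i ^ j) = (\<Sum>i = 1..6. y i ^ j)"
proof
  fix j :: nat
  assume "j \<in> {1, 2, 3, 4, 5}"
  then consider "odd j" | "j = 2" | "j = 4"
    by auto
  then show "(\<Sum>i = 1..6. x i ^ j) = (\<Sum>i = 1..6. y i ^ j)"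
  proof cases
    case 1
    then show ?thesis
      unfolding sum_one_to_six assms by simp
  next
    \<comment> \<open>For even \<open>j\<close> signs disappear, so each side is twice the sum over
      its triple.\<close>
    case 2
    then show ?thesis
      unfolding sum_one_to_six assms using psi_sum_squares[of p q r a b c] by simp
  next
    case 3
    then show ?thesis
      unfolding sum_one_to_six assms using psi_sum_fourth_powers[of p q r a b c] by simp
  qed
qed

end
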